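(* For every nonnegative integer $n$ and every $T\subseteq[n]$, the sequence $(p^T_{n,0}(x),p^T_{n,1}(x),\dots,p^T_{n,n}(x))$ is an interlacing sequence of real-rooted polynomials. In particular, for every positive integer $n$ and every $T\subseteq[n]$, the polynomial $A^{T-1}_n(x)$ is real-rooted and interlaces $A^T_{n+1}(x)$.
   Context: $[m]=\{1,\dots,m\}$, $\mathfrak{S}_m$ is the symmetric group on $[m]$; for $w\in\mathfrak{S}_m$, $\mathrm{Des}(w)=\{i\in[m-1]:w(i)>w(i+1)\}$ and $\mathrm{des}(w)=|\mathrm{Des}(w)|$. For any set $T$ of integers, $A^T_m(x)=\sum_{w\in\mathfrak{S}_m:\ \mathrm{Des}(w)\subseteq T}x^{\mathrm{des}(w)}$, and $T-1=\{a-1:a\in T\}$. For $T\subseteq[n]$ and $k\in\{0,\dots,n\}$, $p^T_{n,k}(x)=\sum x^{\mathrm{des}(w)}$, the sum over all $w\in\mathfrak{S}_{n+1}$ with $w(1)=k+1$ and $\mathrm{Des}(w)\subseteq T$. A polynomial is real-rooted if all its roots are real or it is identically zero. For real-rooted $p$ with roots $\alpha_1\ge\alpha_2\ge\cdots$ and $q$ with roots $\beta_1\ge\beta_2\ge\cdots$, $p$ interlaces $q$ ($p\preceq q$) if $\cdots\le\alpha_2\le\beta_2\le\alpha_1\le\beta_1$; the zero polynomial interlaces and is interlaced by every real-rooted polynomial, and nonzero constants interlace every polynomial of degree at most one. A sequence $(p_0,\dots,p_m)$ of real-rooted polynomials is interlacing if $p_i\preceq p_j$ for all $0\le i<j\le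 m$. *)

theory Defs
  imports
    Complex_Main
    "HOL-Computational_Algebra.Computational_Algebra"
    "HOL-Combinatorics.Permutations"
begin

definition Des :: "nat \<Rightarrow> (nat \<Rightarrow> nat) \<Rightarrow> nat set" where
  "Des m w = {i \<in> {1..<m}. w i > w (i + 1)}"

definition des :: "nat \<Rightarrow> (nat \<Rightarrow> nat) \<Rightarrow> nat" where
  "des m w = card (Des m w)"

(* T is an arbitrary set of integers; elements outside {1..<m} are irrelevant. *)
definition A_poly :: "int set \<Rightarrow> nat \<Rightarrow> real poly" where
  "A_poly T m = (\<Sum>w | w permutes {1..m} \<and> int ` Des m w \<subseteq> T. monom 1 (des m w))"

definition p_poly :: "int set \<Rightarrow> nat \<Rightarrow> nat \<Rightarrow> real poly" where
  "p_poly T n k =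
    (\<Sum>w | w permutes {1..n + 1} \<and> w 1 = k + 1 \<and> int ` Des (n + 1) w \<subseteq> T.
       monom 1 (des (n + 1) w))"

definition real_rooted :: "real poly \<Rightarrow> bool" where
  "real_rooted p \<longleftrightarrow>
     p = 0 \<or> (\<forall>z::complex. poly (map_poly of_real p) z = 0 \<longrightarrow> z \<in> \<real>)"

(* The real roots, listed with multiplicity in weakly decreasing order. *)
definition desc_roots :: "real poly \<Rightarrow> real list" where
  "desc_roots p = rev (sorted_list_of_multiset (proots p))"

(* The chain ... <= as!1 <= bs!1 <= as!0 <= bs!0 starts with a root of q and
   alternates until both lists are exhausted, so q has as many roots as p or
   exactly one more. Nonzero constants are covered: with as = [] the chain
   condition says precisely that q has at most one root. *)
definition interlaces :: "real poly \<Rightarrow> real poly \<Rightarrow> bool" where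
  "interlaces p q \<longleftrightarrow>
     real_rooted p \<and> real_rooted q \<and>
     (p = 0 \<or> q = 0 \<or>
      (let as = desc_roots p; bs = desc_roots q in
         length as \<le> length bs \<and> length bs \<le> length as + 1 \<and>
         (\<forall>i < length as. as ! i \<le> bs ! i) \<and>
         (\<forall>i. i + 1 < length bs \<longrightarrow> bs ! (i + 1) \<le> as ! i)))"

definition interlacing_seq :: "real poly list \<Rightarrow> bool" where
  "interlacing_seq ps \<longleftrightarrow>
     (\<forall>p \<in> set ps. real_rooted p) \<and>
     (\<forall>i j. i < j \<and> j < length ps \<longrightarrow> interlaces (ps ! i) (ps ! j))"

end

theory Submission
  imports Defs
begin

text \<open>
  Fix \<open>z\<close> in the open upper half-plane and write \<open>f \<le> g\<close> if \<open>g(z) / f(z)\<close> lies in the cone spanned by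
  \<open>1\<close> and \<open>z\<close>. Deleting the first letter of a permutation gives
  \<open>p\<^sup>T\<^sub>n\<^sub>+\<^sub>1\<^sub>,\<^sub>k = c (\<Sum>l<k. p\<^sup>T\<^sup>-\<^sup>1\<^sub>n\<^sub>,\<^sub>l) + (\<Sum>l\<ge>k. p\<^sup>T\<^sup>-\<^sup>1\<^sub>n\<^sub>,\<^sub>l)\<close>, where \<open>c\<close> is
  \<open>x\<close> or \<open>0\<close> according to whether \<open>1 \<in> T\<close>. The relation \<open>\<le>\<close> amounts to the nonnegativity of two
  real bilinear forms, so one checks for each \<open>z\<close> separately that this recursion preserves being
  increasing for \<open>\<le>\<close> and having no zeros at \<open>z\<close>. Finally, if \<open>Im (g/f) \<ge> 0\<close> on the upper half-plane,
  then following \<open>arg g - arg f\<close> along a line \<open>Im z = e\<close> and letting \<open>e\<close> tend to \<open>0\<close> shows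
  that, beyond any real \<open>t\<close>, \<open>g\<close> has as many roots as \<open>f\<close> or exactly one more; this is interlacing.
\<close>

subsection \<open>Interlacing from a half-plane condition\<close>

abbreviation cpoly :: "real poly \<Rightarrow> complex \<Rightarrow> complex" where
  "cpoly p z \<equiv> poly (map_poly of_real p) z"

lemma cpoly_add [simp]: "cpoly (p + q) z = cpoly p z + cpoly q z"
proof -
  have "map_poly complex_of_real (p + q) = map_poly of_real p + map_poly of_real q"
    by (rule poly_eqI) (simp add: coeff_map_poly)
  then show ?thesis by simp
qed

lemma cpoly_smult [simp]: "cpoly (smult c p) z = of_real c * cpoly p z"
proof -
  have "map_poly complex_of_real (smult c p) = smult (of_real c) (map_poly of_real p)"
    by (rule poly_eqI) (simp add: coeff_map_poly)
  then show ?thesis by simp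
qed

lemma cpoly_mult [simp]: "cpoly (p * q) z = cpoly p z * cpoly q z"
  by (induction p) (auto simp: map_poly_pCons algebra_simps)

lemma cpoly_sum [simp]: "cpoly (\<Sum>i\<in>A. f i) z = (\<Sum>i\<in>A. cpoly (f i) z)"
  by (induction A rule: infinite_finite_induct) auto

lemma cpoly_cnj: "cpoly p (cnj z) = cnj (cpoly p z)"
  by (subst poly_cnj_real) (auto simp: coeff_map_poly)

lemma cpoly_of_real: "cpoly p (of_real t) = of_real (poly p t)"
  by (induction p) (auto simp: map_poly_pCons)

text \<open>Nonreal roots of a real polynomial come in conjugate pairs.\<close>

lemma real_rootedI:
  assumes "\<And>z. Im z > 0 \<Longrightarrow> cpoly p z \<noteq> 0"
  shows "real_rooted p"
  unfolding real_rooted_def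
proof (intro disjI2 allI impI)
  fix z assume z: "cpoly p z = 0"
  then have "cpoly p (cnj z) = 0"
    by (simp add: cpoly_cnj)
  with z assms[of z] assms[of "cnj z"] have "Im z = 0"
    by (cases "Im z" "0::real" rule: linorder_cases) auto
  then show "z \<in> \<real>"
    by (simp add: complex_is_Real_iff)
qed

text \<open>Induction on the degree: the fundamental theorem of algebra yields a root, real by
  hypothesis, and its linear factor is divided out.\<close>

lemma real_rooted_splits:
  assumes "real_rooted p" "p \<noteq> 0"
  shows "p = smult (lead_coeff p) (\<Prod>a\<in>#proots p. [:-a, 1:])"
  using assms
proof (induction "degree p" arbitrary: p)
  case 0
  then obtain c where "p = [:c:]" by (metis degree_eq_zeroE)
  then show ?case by simp
next
  case (Suc n)
  have "\<not> constant (poly (map_poly complex_of_real p))"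
    using Suc.hyps(2) by (simp add: constant_degree degree_map_poly)
  then obtain z where z: "cpoly p z = 0"
    using fundamental_theorem_of_algebra by blast
  with Suc.prems obtain a where "z = of_real a"
    unfolding real_rooted_def Reals_def by blast
  with z have "complex_of_real (poly p a) = 0"
    by (simp add: cpoly_of_real)
  then obtain q where q: "p = [:-a, 1:] * q"
    by (metis of_real_eq_0_iff poly_eq_0_iff_dvd dvd_def)
  with Suc.prems have "q \<noteq> 0" by auto
  with q Suc.hyps(2) have "degree q = n"
    by (simp add: degree_mult_eq del: mult_pCons_left)
  moreover have "real_rooted q"
    using Suc.prems unfolding real_rooted_def q by (auto simp del: mult_pCons_left)
  ultimately have IH: "q = smult (lead_coeff q) (\<Prod>a\<in>#proots q. [:-a, 1:])"
    using Suc.hyps(1)[of q] \<open>q \<noteq> 0\<close> by blast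
  have "proots p = add_mset a (proots q)"
    using \<open>q \<noteq> 0\<close> unfolding q by (subst proots_mult) auto
  then have "smult (lead_coeff p) (\<Prod>a\<in>#proots p. [:-a, 1:])
    = [:-a, 1:] * smult (lead_coeff q) (\<Prod>a\<in>#proots q. [:-a, 1:])"
    unfolding q lead_coeff_mult by simp
  with IH q show ?case by simp
qed

section \<open>Arguments of real-rooted polynomials along horizontal lines\<close>

text \<open>
  \<open>arg_factor e t a\<close> is the argument of \<open>t - a + i e\<close>, provided \<open>e > 0\<close>.
\<close>

definition arg_factor :: "real \<Rightarrow> real \<Rightarrow> real \<Rightarrow> real" where
  "arg_factor e t a = pi / 2 - arctan ((t - a) / e)"

text \<open>Summing the arguments of the factors, rather than taking a principal argument of the
  product, gives for \<open>e > 0\<close> a choice continuous in \<open>t\<close>.\<close>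

definition arg_prod :: "real multiset \<Rightarrow> real \<Rightarrow> real \<Rightarrow> real" where
  "arg_prod A e t = (\<Sum>a\<in>#A. arg_factor e t a)"

lemma arg_factor_polar:
  assumes "e > 0"
  shows "\<exists>r>0. Complex (t - a) e = of_real r * cis (arg_factor e t a)"
proof (intro exI conjI)
  let ?s = "sqrt (1 + ((t - a) / e)\<^sup>2)"
  have s: "?s > 0" by (simp add: add_pos_nonneg)
  then show "e * ?s > 0" using assms by simp
  have "cis (arg_factor e t a) = Complex ((t - a) / e / ?s) (1 / ?s)"
    unfolding arg_factor_def
    by (simp add: complex_eq_iff cos_diff sin_diff cos_arctan sin_arctan)
  then show "Complex (t - a) e = of_real (e * ?s) * cis (arg_factor e t a)"
    using s assms by (simp add: complex_eq_iff)
qed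

lemma prod_factors_polar:
  assumes "e > 0"
  shows "\<exists>r>0. cpoly (\<Prod>a\<in>#A. [:-a, 1:]) (Complex t e) = of_real r * cis (arg_prod A e t)"
proof (induction A)
  case empty
  then show ?case by (intro exI[of _ 1]) (simp add: arg_prod_def)
next
  case (add a A)
  then obtain r where r: "r > 0"
    "cpoly (\<Prod>a\<in>#A. [:-a, 1:]) (Complex t e) = of_real r * cis (arg_prod A e t)"
    by blast
  obtain s where s: "s > 0" "Complex (t - a) e = of_real s * cis (arg_factor e t a)"
    using arg_factor_polar[OF assms] by blast
  have "cpoly [:-a, 1:] (Complex t e) = Complex (t - a) e"
    by (simp add: map_poly_pCons complex_eq_iff)
  then have "cpoly (\<Prod>a\<in>#add_mset a A. [:-a, 1:]) (Complex t e)
      = Complex (t - a) e * (of_real r * cis (arg_prod A e t))"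
    using r(2) by (simp del: mult_pCons_left)
  also have "\<dots> = of_real (s * r) * cis (arg_prod (add_mset a A) e t)"
    unfolding s(2) by (simp add: arg_prod_def flip: cis_mult)
  finally show ?case using r(1) s(1) by (intro exI[of _ "s * r"]) simp
qed

lemma real_rooted_polar:
  assumes "real_rooted p" "lead_coeff p > 0" "e > 0"
  shows "\<exists>r>0. cpoly p (Complex t e) = of_real r * cis (arg_prod (proots p) e t)"
proof -
  have "p \<noteq> 0" using assms(2) by auto
  obtain r where r: "r > 0" "cpoly (\<Prod>a\<in>#proots p. [:-a, 1:]) (Complex t e)
      = of_real r * cis (arg_prod (proots p) e t)"
    using prod_factors_polar[OF assms(3)] by blast
  have "cpoly p (Complex t e) = of_real (lead_coeff p) * cpoly (\<Prod>a\<in>#proots p. [:-a, 1:]) (Complex t e)"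
    by (subst real_rooted_splits[OF assms(1) \<open>p \<noteq> 0\<close>]) (rule cpoly_smult)
  then show ?thesis
    using r assms(2) by (intro exI[of _ "lead_coeff p * r"]) simp
qed

lemma isCont_arg_prod: "e > 0 \<Longrightarrow> isCont (arg_prod A e) t"
  unfolding arg_prod_def
  by (induction A) (auto simp: arg_factor_def intro!: continuous_intros)

lemma arg_prod_at_top:
  assumes "e > 0"
  shows "(arg_prod A e \<longlongrightarrow> 0) at_top"
proof (induction A)
  case empty
  then show ?case by (simp add: arg_prod_def)
next
  case (add a A)
  have "filterlim (\<lambda>t. t - a) at_top at_top"
    using filterlim_tendsto_add_at_top[OF tendsto_const[of "-a"] filterlim_ident]
    by (simp add: algebra_simps)
  then have "filterlim (\<lambda>t. (t - a) / e) at_top at_top"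
    using assms filterlim_at_top_mult_tendsto_pos[of "\<lambda>_. inverse e" "inverse e"]
    by (auto simp: divide_inverse)
  then have "((\<lambda>t. arctan ((t - a) / e)) \<longlongrightarrow> pi / 2) at_top"
    by (rule filterlim_compose[OF tendsto_arctan_at_top])
  then have "((\<lambda>t. arg_factor e t a) \<longlongrightarrow> pi / 2 - pi / 2) at_top"
    unfolding arg_factor_def by (intro tendsto_diff tendsto_const)
  from tendsto_add[OF this add] show ?case
    by (simp add: arg_prod_def)
qed

text \<open>In the limit a root to the right of \<open>t\<close> contributes \<open>pi\<close> and
  one to the left contributes 0. A root at \<open>t\<close> itself would contribute
  \<open>pi / 2\<close>, hence the hypothesis.\<close>

lemma arg_prod_at_0:
  assumes "t \<notin># A"
  shows "((\<lambda>e. arg_prod A e t) \<longlongrightarrow> pi * real (size (filter_mset (\<lambda>a. t < a) A))) (at_right 0)"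
  using assms
proof (induction A)
  case empty
  then show ?case by (simp add: arg_prod_def)
next
  case (add a A)
  have inv: "filterlim (\<lambda>e::real. inverse e) at_top (at_right 0)"
    by (rule filterlim_inverse_at_top_right)
  have "((\<lambda>e. arg_factor e t a) \<longlongrightarrow> (if t < a then pi else 0)) (at_right 0)"
  proof (cases "t < a")
    case True
    then have "filterlim (\<lambda>e. (t - a) / e) at_bot (at_right 0)"
      using filterlim_tendsto_neg_mult_at_bot[OF tendsto_const _ inv, of "t - a"]
      by (simp add: divide_inverse)
    then have "((\<lambda>e. arctan ((t - a) / e)) \<longlongrightarrow> - (pi / 2)) (at_right 0)"
      by (rule filterlim_compose[OF tendsto_arctan_at_bot])
    then have "((\<lambda>e. arg_factor e t a) \<longlongrightarrow> pi / 2 - - (pi / 2)) (at_right 0)"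
      unfolding arg_factor_def by (intro tendsto_diff tendsto_const)
    with True show ?thesis by simp
  next
    case False
    with add.prems have "t > a" by auto
    then have "filterlim (\<lambda>e. (t - a) / e) at_top (at_right 0)"
      using filterlim_tendsto_pos_mult_at_top[OF tendsto_const _ inv, of "t - a"]
      by (simp add: divide_inverse)
    then have "((\<lambda>e. arctan ((t - a) / e)) \<longlongrightarrow> pi / 2) (at_right 0)"
      by (rule filterlim_compose[OF tendsto_arctan_at_top])
    then have "((\<lambda>e. arg_factor e t a) \<longlongrightarrow> pi / 2 - pi / 2) (at_right 0)"
      unfolding arg_factor_def by (intro tendsto_diff tendsto_const)
    with False show ?thesis by simp
  qed
  from tendsto_add[OF this add.IH] add.prems show ?case
    by (cases "t < a") (simp_all add: arg_prod_def algebra_simps)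
qed

text \<open>The argument difference at \<open>t\<close> is confined to an interval of length
  \<open>2 * pi\<close> and tends to \<open>pi * (N g - N f)\<close> as the line approaches the real
  axis. This leaves only 0 and 1 for the integer \<open>N g - N f\<close>.\<close>

lemma root_count_interlaces:
  assumes f: "real_rooted f" "lead_coeff f > 0" and g: "real_rooted g" "lead_coeff g > 0"
    and pos: "\<And>z. Im z > 0 \<Longrightarrow> Im (cnj (cpoly f z) * cpoly g z) \<ge> 0"
    and t: "poly f t \<noteq> 0" "poly g t \<noteq> 0"
  defines "N \<equiv> \<lambda>p. size (filter_mset (\<lambda>a. t < a) (proots p))"
  shows "N f \<le> N g \<and> N g \<le> N f + 1"
proof -
  define D where "D = (\<lambda>e s. arg_prod (proots g) e s - arg_prod (proots f) e s)"
  \<comment> \<open>Up to a positive factor, the imaginary part in \<open>pos\<close> is the sine of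
    \<open>D e s\<close>.\<close>
  have sin: "sin (D e s) \<ge> 0" if e: "e > 0" for e s
  proof -
    obtain r where r: "r > 0" "cpoly f (Complex s e) = of_real r * cis (arg_prod (proots f) e s)"
      using real_rooted_polar[OF f e] by blast
    obtain q where q: "q > 0" "cpoly g (Complex s e) = of_real q * cis (arg_prod (proots g) e s)"
      using real_rooted_polar[OF g e] by blast
    have "cnj (cpoly f (Complex s e)) * cpoly g (Complex s e) = of_real (r * q) * cis (D e s)"
      unfolding r(2) q(2) D_def by (simp add: cis_cnj cis_mult)
    then have "Im (cnj (cpoly f (Complex s e)) * cpoly g (Complex s e)) = r * q * sin (D e s)"
      by simp
    then have "0 \<le> r * q * sin (D e s)"
      using pos[of "Complex s e"] e by simp
    moreover have "r * q > 0" using r q by simp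
    ultimately show ?thesis
      by (simp add: zero_le_mult_iff)
  qed
  text \<open>\<open>D e\<close> tends to 0 at infinity and cannot cross a value at which the sine is -1.\<close>
  have range: "- (pi / 2) < D e t \<and> D e t < 3 * pi / 2" if e: "e > 0" for e
  proof -
    have cont: "\<forall>s. t \<le> s \<and> s \<le> b \<longrightarrow> isCont (D e) s" for b
      unfolding D_def using e by (auto intro!: continuous_intros isCont_arg_prod)
    have "(D e \<longlongrightarrow> 0 - 0) at_top"
      unfolding D_def using e by (intro tendsto_diff arg_prod_at_top)
    then have "eventually (\<lambda>s. dist (D e s) 0 < pi / 2) at_top"
      by (intro tendstoD) auto
    then have "eventually (\<lambda>s. dist (D e s) 0 < pi / 2 \<and> t \<le> s) at_top"
      using eventually_ge_at_top eventually_conj by blast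
    then obtain b where b: "\<bar>D e b\<bar> < pi / 2" "t \<le> b"
      by (auto simp: eventually_at_top_linorder)
    have "D e s \<noteq> - (pi / 2)" for s
      using sin[OF e, of s] by auto
    moreover have "D e s \<noteq> 3 * pi / 2" for s
    proof
      assume "D e s = 3 * pi / 2"
      then have "D e s = - (pi / 2) + 2 * pi" by simp
      then have "sin (D e s) = -1"
        by (simp only: sin_periodic) simp
      with sin[OF e, of s] show False by simp
    qed
    \<comment> \<open>At \<open>b\<close> the value is already inside the interval, so by continuity
      leaving it on the way to \<open>t\<close> would mean taking one of the excluded
      values.\<close>
    ultimately show ?thesis
      using IVT[of "D e" t "- (pi / 2)" b] IVT2[of "D e" b "3 * pi / 2" t] b cont[of b]
      by (smt (verit) pi_gt_zero field_sum_of_halves)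
  qed
  have ne: "f \<noteq> 0" "g \<noteq> 0" using t by auto
  have "((\<lambda>e. D e t) \<longlongrightarrow> pi * real (N g) - pi * real (N f)) (at_right 0)"
    unfolding D_def N_def using t ne by (intro tendsto_diff arg_prod_at_0) auto
  then have "eventually (\<lambda>e. dist (D e t) (pi * real (N g) - pi * real (N f)) < pi / 2) (at_right 0)"
    by (rule tendstoD) simp
  then have "eventually (\<lambda>e. dist (D e t) (pi * real (N g) - pi * real (N f)) < pi / 2 \<and> e > 0) (at_right 0)"
    using eventually_at_right_less eventually_conj by blast
  then obtain e where e: "\<bar>D e t - pi * (real (N g) - real (N f))\<bar> < pi / 2" "e > 0"
    using eventually_happens[of _ "at_right (0::real)"] trivial_limit_at_right_real
    by (fastforce simp: dist_real_def algebra_simps)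
  \<comment> \<open>The open interval for \<open>D e t\<close> is enlarged by the tolerance
    \<open>pi / 2\<close> on both sides.\<close>
  then have "pi * (-1) < pi * (real (N g) - real (N f))" "pi * (real (N g) - real (N f)) < pi * 2"
    using range[of e] by linarith+
  then show ?thesis
    by (simp only: mult_less_cancel_left_pos[OF pi_gt_zero]) linarith
qed

section \<open>From root counts to sorted root lists\<close>

text \<open>In a weakly decreasing list the entries above \<open>t\<close> form an initial
  segment.\<close>

lemma length_filter_gt_iff:
  fixes xs :: "real list"
  assumes "sorted_wrt (\<ge>) xs"
  shows "i < length (filter (\<lambda>x. t < x) xs) \<longleftrightarrow> i < length xs \<and> t < xs ! i"
  using assms
proof (induction xs arbitrary: i)
  case (Cons x xs)
  show ?case
  proof (cases "t < x")
    case True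
    with Cons show ?thesis by (cases i) auto
  next
    case False
    with Cons.prems have "\<forall>y\<in>set (x # xs). \<not> t < y" by auto
    then have "filter (\<lambda>x. t < x) (x # xs) = []"
      by (simp add: filter_empty_conv)
    moreover have "\<not> t < (x # xs) ! i" if "i < length (x # xs)"
      using \<open>\<forall>y\<in>set (x # xs). \<not> t < y\<close> nth_mem[OF that] by blast
    ultimately show ?thesis by auto
  qed
qed simp

lemma mset_desc_roots [simp]: "mset (desc_roots p) = proots p"
  by (simp add: desc_roots_def)

lemma sorted_desc_roots: "sorted_wrt (\<ge>) (desc_roots p)"
  by (simp add: desc_roots_def sorted_wrt_rev)

lemma size_roots_gt:
  "size (filter_mset (\<lambda>a. t < a) (proots p)) = length (filter (\<lambda>a. t < a) (desc_roots p))"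
  by (metis mset_desc_roots mset_filter size_mset)

lemma exists_between_avoiding_roots:
  fixes f :: "real poly"
  assumes "f \<noteq> 0" "a < b"
  shows "\<exists>t. a < t \<and> t < b \<and> poly f t \<noteq> 0"
proof (rule ccontr)
  assume "\<not> ?thesis"
  then have "{a<..<b} \<subseteq> {t. poly f t = 0}" by auto
  then show False
    using poly_roots_finite[OF assms(1)] infinite_Ioo[OF assms(2)] finite_subset by blast
qed

text \<open>A violated inequality would leave a gap containing some \<open>t\<close> at which the
  counts disagree; a \<open>t\<close> below all roots of \<open>p\<close> compares the lengths. The
  roots of \<open>h\<close> are the thresholds to avoid, and the shifts \<open>k = 0\<close> and
  \<open>k = 1\<close> give the two halves of the interlacing chain.\<close>

lemma desc_roots_le_of_count:
  assumes h: "h \<noteq> 0"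
    and count: "\<And>t. poly h t \<noteq> 0 \<Longrightarrow>
      length (filter (\<lambda>a. t < a) (desc_roots p)) \<le> length (filter (\<lambda>a. t < a) (desc_roots q)) + k"
  shows "length (desc_roots p) \<le> length (desc_roots q) + k"
    and "i + k < length (desc_roots p) \<Longrightarrow> desc_roots p ! (i + k) \<le> desc_roots q ! i"
proof -
  \<comment> \<open>Inserting 0 keeps \<open>Min\<close> meaningful when there are no roots.\<close>
  define m where "m = Min (insert 0 (set (desc_roots p)))"
  obtain t where t: "t < m" "poly h t \<noteq> 0"
    using exists_between_avoiding_roots[OF h, of "m - 1" m] by auto
  have "\<forall>a\<in>set (desc_roots p). t < a"
    using t(1) unfolding m_def by auto
  then have "length (filter (\<lambda>a. t < a) (desc_roots p)) = length (desc_roots p)"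
    by simp
  with count[OF t(2)] show len: "length (desc_roots p) \<le> length (desc_roots q) + k"
    using length_filter_le[of "\<lambda>a. t < a" "desc_roots q"] by linarith
  show "desc_roots p ! (i + k) \<le> desc_roots q ! i" if i: "i + k < length (desc_roots p)"
  proof (rule ccontr)
    assume "\<not> ?thesis"
    then obtain t where t: "desc_roots q ! i < t" "t < desc_roots p ! (i + k)" "poly h t \<noteq> 0"
      using exists_between_avoiding_roots[OF h] by (meson not_le)
    have "i + k < length (filter (\<lambda>a. t < a) (desc_roots p))"
      using length_filter_gt_iff[OF sorted_desc_roots] i t(2) by simp
    then have "i < length (filter (\<lambda>a. t < a) (desc_roots q))"
      using count[OF t(3)] by linarith
    then show False
      using length_filter_gt_iff[OF sorted_desc_roots, of i t q] t(1) by simp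
  qed
qed

lemma interlacesI:
  assumes f: "f \<noteq> 0 \<Longrightarrow> lead_coeff f > 0" "\<And>z. Im z > 0 \<Longrightarrow> cpoly f z = 0 \<Longrightarrow> f = 0"
    and g: "g \<noteq> 0 \<Longrightarrow> lead_coeff g > 0" "\<And>z. Im z > 0 \<Longrightarrow> cpoly g z = 0 \<Longrightarrow> g = 0"
    and pos: "\<And>z. Im z > 0 \<Longrightarrow> Im (cnj (cpoly f z) * cpoly g z) \<ge> 0"
  shows "interlaces f g"
proof -
  have rr: "real_rooted f" "real_rooted g"
    using f(2) g(2) real_rootedI[of f] real_rootedI[of g] real_rooted_def by metis+
  show ?thesis
  proof (cases "f = 0 \<or> g = 0")
    case True
    with rr show ?thesis unfolding interlaces_def by blast
  next
    case False
    let ?N = "\<lambda>p t. length (filter (\<lambda>a. t < a) (desc_roots p))"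
    have count: "?N f t \<le> ?N g t \<and> ?N g t \<le> ?N f t + 1" if "poly (f * g) t \<noteq> 0" for t
      using root_count_interlaces[OF rr(1) _ rr(2) _ pos, of t] f(1) g(1) False that
      by (simp add: size_roots_gt)
    have fg: "f * g \<noteq> 0" using False by simp
    have count_fg: "?N f t \<le> ?N g t + 0" and count_gf: "?N g t \<le> ?N f t + 1"
      if "poly (f * g) t \<noteq> 0" for t
      using count[OF that] by simp_all
    show ?thesis
      unfolding interlaces_def Let_def
      using rr desc_roots_le_of_count[OF fg count_fg] desc_roots_le_of_count[OF fg count_gf]
      by simp
  qed
qed

subsection \<open>Sectors of complex numbers\<close>

text \<open>
  For \<open>a \<noteq> 0\<close> and \<open>Im z > 0\<close> this says that \<open>b / a\<close> lies in the cone spanned by \<open>1\<close> and \<open>z\<close>.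
  That this cone is salient is what keeps sums from vanishing.
\<close>

definition sector :: "complex \<Rightarrow> complex \<Rightarrow> complex \<Rightarrow> bool" where
  "sector z a b \<longleftrightarrow> 0 \<le> Im (cnj a * b) \<and> 0 \<le> Im (cnj b * (z * a))"

lemma sector_0 [simp]: "sector z 0 a" "sector z a 0"
  by (simp_all add: sector_def)

lemma sector_add_left: "sector z a c \<Longrightarrow> sector z b c \<Longrightarrow> sector z (a + b) c"
  by (simp add: sector_def algebra_simps)

lemma sector_add_right: "sector z a b \<Longrightarrow> sector z a c \<Longrightarrow> sector z a (b + c)"
  by (simp add: sector_def algebra_simps)

lemma sector_sum_left: "(\<And>i. i \<in> I \<Longrightarrow> sector z (u i) b) \<Longrightarrow> sector z (\<Sum>i\<in>I. u i) b"
  by (induction I rule: infinite_finite_induct) (auto intro: sector_add_left)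

lemma sector_sum_right: "(\<And>i. i \<in> I \<Longrightarrow> sector z a (u i)) \<Longrightarrow> sector z a (\<Sum>i\<in>I. u i)"
  by (induction I rule: infinite_finite_induct) (auto intro: sector_add_right)

lemma sector_sum_sum:
  assumes "\<And>i j. i \<in> I \<Longrightarrow> j \<in> J \<Longrightarrow> sector z (u i) (u j)"
  shows "sector z (\<Sum>i\<in>I. u i) (\<Sum>j\<in>J. u j)"
  using assms by (intro sector_sum_left sector_sum_right)

lemma Im_cnj_mult_self: "Im (cnj a * (z * a)) = (cmod a)\<^sup>2 * Im z"
  unfolding cmod_power2 by (simp add: algebra_simps power2_eq_square)

lemma sector_refl: "Im z > 0 \<Longrightarrow> sector z a a"
  unfolding sector_def Im_cnj_mult_self by (simp add: algebra_simps)

text \<open>For \<open>a \<noteq> 0\<close> the cone does not contain -1: with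
  \<open>b = - a\<close> the second form in \<open>sector\<close> would be negative.\<close>

lemma sector_add_eq_0:
  assumes "Im z > 0" "sector z a b" "a + b = 0"
  shows "a = 0"
proof -
  have "b = - a" using assms(3) by (simp add: eq_neg_iff_add_eq_0 add.commute)
  then have "Im (cnj b * (z * a)) = - ((cmod a)\<^sup>2 * Im z)"
    using Im_cnj_mult_self[of a z] by simp
  with assms(2) have "(cmod a)\<^sup>2 * Im z \<le> 0" by (simp add: sector_def)
  with assms(1) show ?thesis by (simp add: mult_le_0_iff)
qed

text \<open>Likewise the cone does not contain \<open>- z\<close>: with \<open>b = - (z * a)\<close>
  the first form would be negative.\<close>

lemma sector_mult_add_eq_0:
  assumes "Im z > 0" "sector z a b" "z * a + b = 0"
  shows "a = 0"
proof -
  have "b = - (z * a)" using assms(3) by (simp add: eq_neg_iff_add_eq_0 add.commute)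
  then have "Im (cnj a * b) = - ((cmod a)\<^sup>2 * Im z)"
    by (simp add: Im_cnj_mult_self[symmetric])
  with assms(2) have "(cmod a)\<^sup>2 * Im z \<le> 0" by (simp add: sector_def)
  with assms(1) show ?thesis by (simp add: mult_le_0_iff)
qed

text \<open>The sum of all terms but the last is in the sector relation with the last one, so both
  vanish, and induction treats the shorter sum.\<close>

lemma sector_sum_eq_0:
  fixes u :: "nat \<Rightarrow> complex"
  assumes "Im z > 0" "\<And>i j. k \<le> i \<Longrightarrow> i < j \<Longrightarrow> j < n \<Longrightarrow> sector z (u i) (u j)"
    and "(\<Sum>i=k..<n. u i) = 0" "k \<le> i" "i < n"
  shows "u i = 0"
  using assms(2-)
proof (induction n)
  case (Suc n)
  then have split: "(\<Sum>i=k..<n. u i) + u n = 0" by simp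
  have "sector z (\<Sum>i=k..<n. u i) (u n)"
    using Suc.prems(1) by (intro sector_sum_left) auto
  with split have 0: "(\<Sum>i=k..<n. u i) = 0"
    using sector_add_eq_0[OF assms(1)] by blast
  show ?case
  proof (cases "i = n")
    case True
    with 0 split show ?thesis by simp
  next
    case False
    with Suc 0 show ?thesis by auto
  qed
qed simp

lemma Im_cnj_mult_both: "Im (cnj (z * a) * (z * b)) = (cmod z)\<^sup>2 * Im (cnj a * b)"
  unfolding cmod_power2 by (simp add: algebra_simps power2_eq_square)

text \<open>In the recursion \<open>a\<close>, \<open>b\<close>, \<open>c\<close> are a lower, a
  middle and an upper block of terms, and only the middle one gains the factor \<open>z\<close>.
  With the common part \<open>d = z * a + c\<close> the two sides are \<open>d + b\<close> and
  \<open>d + z * b\<close>, and both forms expand into nonnegative terms.\<close>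

lemma sector_step:
  assumes z: "Im z > 0" and ab: "sector z a b" and ac: "sector z a c" and bc: "sector z b c"
  shows "sector z (z * a + (b + c)) (z * (a + b) + c)"
proof -
  define d where "d = z * a + c"
  have db: "Im (cnj d * (z * b)) = (cmod z)\<^sup>2 * Im (cnj a * b) + Im (cnj c * (z * b))"
    unfolding d_def Im_cnj_mult_both[symmetric] by (simp add: algebra_simps)
  have bd: "Im (cnj b * d) = Im (cnj b * (z * a)) + Im (cnj b * c)"
    unfolding d_def by (simp add: algebra_simps)
  have 1: "Im (cnj (d + b) * (d + z * b)) =
      Im (cnj d * (z * b)) + Im (cnj b * d) + (cmod b)\<^sup>2 * Im z"
    unfolding Im_cnj_mult_self[symmetric] by (simp add: algebra_simps)
  have 2: "Im (cnj (d + z * b) * (z * (d + b))) =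
      (cmod d)\<^sup>2 * Im z + Im (cnj d * (z * b)) + (cmod z)\<^sup>2 * Im (cnj b * d)"
    unfolding Im_cnj_mult_self[symmetric] Im_cnj_mult_both[symmetric] by (simp add: algebra_simps)
  have "0 \<le> Im (cnj d * (z * b))" "0 \<le> Im (cnj b * d)"
    unfolding db bd using ab bc by (simp_all add: sector_def)
  then have "sector z (d + b) (d + z * b)"
    unfolding sector_def 1 2 using z by simp
  then show ?thesis by (simp add: d_def algebra_simps)
qed

section \<open>Sequences of polynomials in sector position\<close>

text \<open>Zero members are allowed because restricting the descents may leave no permutation with
  a given first letter.\<close>

definition sector_seq :: "nat \<Rightarrow> (nat \<Rightarrow> real poly) \<Rightarrow> bool" where
  "sector_seq N p \<longleftrightarrow> (\<forall>z. Im z > 0 \<longrightarrow>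
     (\<forall>i<N. cpoly (p i) z = 0 \<longrightarrow> p i = 0) \<and>
     (\<forall>i j. i < j \<longrightarrow> j < N \<longrightarrow> sector z (cpoly (p i) z) (cpoly (p j) z)))"

lemma sector_seq_step:
  assumes p: "sector_seq N p" and c: "c = 0 \<or> c = [:0, 1:]"
    and q: "\<And>k. k \<le> N \<Longrightarrow> q k = c * (\<Sum>l<k. p l) + (\<Sum>l=k..<N. p l)"
  shows "sector_seq (Suc N) q"
  unfolding sector_seq_def
proof (intro allI impI conjI)
  fix z :: complex assume z: "Im z > 0"
  define u where "u l = cpoly (p l) z" for l
  have nz: "p l = 0" if "u l = 0" "l < N" for l
    using p z that by (auto simp: sector_seq_def u_def)
  have u: "sector z (u i) (u j)" if "i < j" "j < N" for i j
    using p z that by (auto simp: sector_seq_def u_def)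
  have qz: "cpoly (q k) z = cpoly c z * (\<Sum>l<k. u l) + (\<Sum>l=k..<N. u l)" if "k \<le> N" for k
    unfolding q[OF that] by (simp add: u_def)
  have cz: "cpoly c z = (if c = 0 then 0 else z)"
    using c by (auto simp: map_poly_pCons)
  {
    fix k assume k: "k < Suc N" and 0: "cpoly (q k) z = 0"
    have sec: "sector z (\<Sum>l<k. u l) (\<Sum>l=k..<N. u l)"
      using u by (intro sector_sum_sum) auto
    \<comment> \<open>For \<open>c = 0\<close> the lower sum drops out; otherwise the salient cone
      forces it to vanish at \<open>z\<close>.\<close>
    have low: "c = 0 \<or> (\<Sum>l<k. u l) = 0"
    proof (cases "c = 0")
      case False
      then have "z * (\<Sum>l<k. u l) + (\<Sum>l=k..<N. u l) = 0"
        using 0 qz[of k] k cz by simp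
      then show ?thesis
        using sector_mult_add_eq_0[OF z sec] by blast
    qed simp
    then have high: "(\<Sum>l=k..<N. u l) = 0"
      using 0 qz[of k] k cz by auto
    have "p l = 0" if "k \<le> l" "l < N" for l
      using sector_sum_eq_0[OF z u high that] nz that by simp
    then have sum_high: "(\<Sum>l=k..<N. p l) = 0"
      by simp
    have "c * (\<Sum>l<k. p l) = 0"
      using low
    proof
      assume "(\<Sum>l<k. u l) = 0"
      then have 00: "(\<Sum>l=0..<k. u l) = 0" by (simp add: lessThan_atLeast0)
      have "p l = 0" if "l < k" for l
      proof (rule nz)
        show "u l = 0"
          by (rule sector_sum_eq_0[OF z u 00]) (use that k in simp_all)
      qed (use that k in simp)
      then show ?thesis by simp
    qed simp
    then show "q k = 0"
      using q[of k] k sum_high by simp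
  }
  fix i j assume ij: "i < j" "j < Suc N"
  \<comment> \<open>The block \<open>B\<close> changes sides: it lies in the upper sum of
    \<open>q i\<close> and in the lower sum of \<open>q j\<close>.\<close>
  define A B C where "A = (\<Sum>l<i. u l)" and "B = (\<Sum>l=i..<j. u l)" and "C = (\<Sum>l=j..<N. u l)"
  have "(\<Sum>l=i..<N. u l) = B + C" "(\<Sum>l<j. u l) = A + B"
    unfolding A_def B_def C_def using ij
    by (auto simp: sum.atLeastLessThan_concat lessThan_atLeast0)
  then have eq: "cpoly (q i) z = cpoly c z * A + (B + C)" "cpoly (q j) z = cpoly c z * (A + B) + C"
    using qz[of i] qz[of j] ij by (auto simp: A_def C_def)
  have "sector z A B" "sector z A C" "sector z B C"
    unfolding A_def B_def C_def using u ij by (auto intro!: sector_sum_sum)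
  \<comment> \<open>The first fact serves \<open>c = [:0, 1:]\<close>, the second
    \<open>c = 0\<close>.\<close>
  then have "sector z (z * A + (B + C)) (z * (A + B) + C)" "sector z (B + C) C"
    using sector_step[OF z] sector_add_left[OF _ sector_refl[OF z]] by auto
  then show "sector z (cpoly (q i) z) (cpoly (q j) z)"
    unfolding eq cz by simp
qed

text \<open>\<open>p 0\<close> is in the sector relation with itself and with every later member,
  hence with their sum.\<close>

lemma sector_seq_interlaces_sum:
  assumes p: "sector_seq N p" and lc: "\<And>i. i < N \<Longrightarrow> p i \<noteq> 0 \<Longrightarrow> lead_coeff (p i) > 0"
    and lcs: "(\<Sum>k<N. p k) \<noteq> 0 \<Longrightarrow> lead_coeff (\<Sum>k<N. p k) > 0" and N: "N > 0"
  shows "interlaces (p 0) (\<Sum>k<N. p k)"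
proof (rule interlacesI)
  fix z :: complex assume z: "Im z > 0"
  have sec: "sector z (cpoly (p i) z) (cpoly (p j) z)" if "i < j" "j < N" for i j
    using p z that by (auto simp: sector_seq_def)
  show nz: "p 0 = 0" if "cpoly (p 0) z = 0"
    using p z N that by (auto simp: sector_seq_def)
  have "sector z (cpoly (p 0) z) (\<Sum>k<N. cpoly (p k) z)"
    using sec sector_refl[OF z] by (intro sector_sum_right) (metis gr0I lessThan_iff)
  then show "Im (cnj (cpoly (p 0) z) * cpoly (\<Sum>k<N. p k) z) \<ge> 0"
    by (simp add: sector_def)
  show "(\<Sum>k<N. p k) = 0" if "cpoly (\<Sum>k<N. p k) z = 0"
  proof (rule sum.neutral, safe)
    fix k assume "k < N"
    then have "cpoly (p k) z = 0"
      using sector_sum_eq_0[OF z, of 0 N "\<lambda>k. cpoly (p k) z"] that sec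
      by (auto simp: lessThan_atLeast0)
    with \<open>k < N\<close> show "p k = 0"
      using p z by (auto simp: sector_seq_def)
  qed
qed (use lc lcs N in auto)

subsection \<open>Recursion on the first letter\<close>

text \<open>Order-preserving relabelling that frees the value \<open>k + 1\<close> for a new first
  letter; \<open>unbump\<close> closes the gap again.\<close>

definition bump :: "nat \<Rightarrow> nat \<Rightarrow> nat" where
  "bump k v = (if v \<le> k then v else Suc v)"

definition unbump :: "nat \<Rightarrow> nat \<Rightarrow> nat" where
  "unbump k v = (if v \<le> k then v else v - 1)"

text \<open>Position 0 is fixed because \<open>permutes\<close> demands it outside
  \<open>{1..m}\<close>.\<close>

definition prepend :: "nat \<Rightarrow> (nat \<Rightarrow> nat) \<Rightarrow> nat \<Rightarrow> nat" where
  "prepend k w i = (if i = 0 then 0 else if i = 1 then k + 1 else bump k (w (i - 1)))"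

definition behead :: "nat \<Rightarrow> (nat \<Rightarrow> nat) \<Rightarrow> nat \<Rightarrow> nat" where
  "behead k w i = (if i = 0 then 0 else unbump k (w (i + 1)))"

lemma prepend_permutes:
  assumes w: "w permutes {1..m}" and "k \<le> m"
  shows "prepend k w permutes {1..Suc m}"
proof (rule inj_imp_permutes)
  have "w i = w j \<longleftrightarrow> i = j" for i j
    using permutes_inj[OF w] by (auto dest: injD)
  then show "inj_on (prepend k w) {1..Suc m}"
    by (auto simp: inj_on_def prepend_def bump_def split: if_splits)
next
  fix i assume "i \<in> {1..Suc m}"
  then show "prepend k w i \<in> {1..Suc m}"
    using permutes_in_image[OF w, of "i - 1"] \<open>k \<le> m\<close>
    by (auto simp: prepend_def bump_def)
next
  fix i assume "i \<notin> {1..Suc m}"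
  then consider "i = 0" | j where "i = Suc j" "j > m"
    by (cases i) auto
  then show "prepend k w i = i"
  proof cases
    case 2
    then show ?thesis
      using permutes_not_in[OF w, of j] \<open>k \<le> m\<close> by (simp add: prepend_def bump_def)
  qed (simp add: prepend_def)
qed simp

lemma behead_permutes:
  assumes w: "w permutes {1..Suc m}" and w1: "w 1 = k + 1" and "k \<le> m"
  shows "behead k w permutes {1..m}"
proof (rule inj_imp_permutes)
  have eq: "w i = w j \<longleftrightarrow> i = j" for i j
    using permutes_inj[OF w] by (auto dest: injD)
  then have ne: "w (Suc i) \<noteq> Suc k" if "i > 0" for i
    using w1 that by (metis One_nat_def Suc_eq_plus1 nat.inject neq0_conv)
  show "inj_on (behead k w) {1..m}"
  proof (rule inj_onI)
    fix i j assume ij: "i \<in> {1..m}" "j \<in> {1..m}" "behead k w i = behead k w j"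
    then have "w (Suc i) = w (Suc j)"
      using ne[of i] ne[of j] by (auto simp: behead_def unbump_def split: if_splits)
    then show "i = j" by (simp add: eq)
  qed
  fix i
  show "behead k w i \<in> {1..m}" if "i \<in> {1..m}"
    using permutes_in_image[OF w, of "i + 1"] \<open>k \<le> m\<close> that ne[of i]
    by (auto simp: behead_def unbump_def)
  show "behead k w i = i" if "i \<notin> {1..m}"
    using permutes_not_in[OF w, of "i + 1"] \<open>k \<le> m\<close> that
    by (auto simp: behead_def unbump_def)
qed simp

lemma bij_betw_prepend:
  assumes "k \<le> m"
  shows "bij_betw (prepend k) {w. w permutes {1..m}} {w. w permutes {1..Suc m} \<and> w 1 = k + 1}"
proof (rule bij_betw_byWitness[where f' = "behead k"])
  show "\<forall>w\<in>{w. w permutes {1..m}}. behead k (prepend k w) = w"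
  proof (intro ballI ext)
    fix w i assume "w \<in> {w. w permutes {1..m}}"
    then have "w 0 = 0" by (auto simp: permutes_not_in)
    then show "behead k (prepend k w) i = w i"
      by (auto simp: behead_def prepend_def bump_def unbump_def)
  qed
  show "\<forall>w\<in>{w. w permutes {1..Suc m} \<and> w 1 = k + 1}. prepend k (behead k w) = w"
  proof (intro ballI ext)
    fix w i assume w: "w \<in> {w. w permutes {1..Suc m} \<and> w 1 = k + 1}"
    then have "w 0 = 0" by (auto simp: permutes_not_in)
    moreover have "w i \<noteq> Suc k" if "i \<noteq> 1"
      using w that permutes_inj[of w] by (metis (mono_tags) Suc_eq_plus1 injD mem_Collect_eq)
    ultimately show "prepend k (behead k w) i = w i"
      using w by (auto simp: behead_def prepend_def bump_def unbump_def)
  qed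
qed (use prepend_permutes behead_permutes assms in \<open>auto simp: prepend_def\<close>)

text \<open>Position 1 is a descent exactly when the old first letter keeps its value under
  \<open>bump k\<close>. Strict monotonicity of \<open>bump k\<close> carries the other descents
  over, shifted by one.\<close>

lemma Des_prepend:
  assumes "m > 0"
  shows "Des (Suc m) (prepend k w) = (if w 1 \<le> k then {1} else {}) \<union> Suc ` Des m w"
proof (rule set_eqI)
  fix i
  consider "i = 0" | "i = 1" | j where "i = Suc j" "j > 0"
    by (metis One_nat_def not0_implies_Suc neq0_conv)
  then show "i \<in> Des (Suc m) (prepend k w) \<longleftrightarrow>
      i \<in> (if w 1 \<le> k then {1} else {}) \<union> Suc ` Des m w"
  proof cases
    case 3
    have "bump k a > bump k b \<longleftrightarrow> a > b" for a b
      by (auto simp: bump_def)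
    with 3 show ?thesis
      by (auto simp: Des_def prepend_def)
  qed (use assms in \<open>auto simp: Des_def prepend_def bump_def\<close>)
qed

section \<open>Descent weights and the recursion for the polynomials\<close>

text \<open>Moving the restriction on descents into the summand frees the index sets from
  \<open>T\<close>, so that bijections and regroupings apply directly.\<close>

definition des_weight :: "int set \<Rightarrow> nat \<Rightarrow> (nat \<Rightarrow> nat) \<Rightarrow> real poly" where
  "des_weight T m w = (if int ` Des m w \<subseteq> T then monom 1 (des m w) else 0)"

lemma finite_Des [simp]: "finite (Des m w)"
  by (simp add: Des_def)

lemma des_weight_prepend:
  assumes "m > 0"
  shows "des_weight T (Suc m) (prepend k w) =
    (if w 1 \<le> k then if 1 \<in> T then [:0, 1:] else 0 else 1) * des_weight ((\<lambda>a. a - 1) ` T) m w"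
proof -
  have sub: "int ` Suc ` Des m w \<subseteq> T \<longleftrightarrow> int ` Des m w \<subseteq> (\<lambda>a. a - 1) ` T"
    by (force simp: image_iff)
  have "1 \<notin> Suc ` Des m w" by (auto simp: Des_def)
  then have "des (Suc m) (prepend k w) = (if w 1 \<le> k then 1 else 0) + des m w"
    unfolding des_def Des_prepend[OF assms] by (simp add: card_image)
  then show ?thesis
    unfolding des_weight_def Des_prepend[OF assms] sub[symmetric]
    by (auto simp: monom_Suc image_Un)
qed

lemma p_poly_altdef:
  "p_poly T n k = (\<Sum>w | w permutes {1..n + 1} \<and> w 1 = k + 1. des_weight T (n + 1) w)"
  unfolding p_poly_def des_weight_def
  by (rule sum.mono_neutral_cong_left) (auto intro: finite_subset[OF _ finite_permutations])

lemma A_poly_altdef: "A_poly T m = (\<Sum>w | w permutes {1..m}. des_weight T m w)"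
  unfolding A_poly_def des_weight_def
  by (rule sum.mono_neutral_cong_left) (auto intro: finite_subset[OF _ finite_permutations])

lemma sum_permutes_by_first:
  fixes g :: "(nat \<Rightarrow> nat) \<Rightarrow> 'a::comm_monoid_add"
  shows "(\<Sum>w | w permutes {1..n + 1}. g w) =
    (\<Sum>l<n + 1. \<Sum>w | w permutes {1..n + 1} \<and> w 1 = l + 1. g w)"
proof -
  have pos: "w 1 \<in> {1..n + 1}" if "w permutes {1..n + 1}" for w
    using permutes_in_image[OF that, of 1] by simp
  have "(\<Sum>w | w permutes {1..n + 1}. g w) =
     (\<Sum>l<n + 1. \<Sum>w\<in>{w \<in> {w. w permutes {1..n + 1}}. w 1 - 1 = l}. g w)"
    using pos by (intro sum.group[symmetric]) (fastforce simp: finite_permutations)+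
  also have "\<dots> = (\<Sum>l<n + 1. \<Sum>w | w permutes {1..n + 1} \<and> w 1 = l + 1. g w)"
  proof (intro sum.cong refl)
    fix l
    show "{w \<in> {w. w permutes {1..n + 1}}. w 1 - 1 = l} = {w. w permutes {1..n + 1} \<and> w 1 = l + 1}"
      using pos by fastforce
  qed
  finally show ?thesis .
qed

lemma A_poly_eq_sum: "A_poly T (n + 1) = (\<Sum>k<n + 1. p_poly T n k)"
  unfolding A_poly_altdef p_poly_altdef by (rule sum_permutes_by_first)

text \<open>Once the first letter \<open>k + 1\<close> is deleted and the rest relabelled, the new
  first letter \<open>l + 1\<close> tells whether position 1 was a descent: this happens exactly for
  \<open>l < k\<close>.\<close>

lemma p_poly_Suc:
  fixes T :: "int set"
  assumes "k \<le> n + 1"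
  defines "S \<equiv> (\<lambda>a. a - 1) ` T"
  shows "p_poly T (Suc n) k = (if 1 \<in> T then [:0, 1:] else 0) * (\<Sum>l<k. p_poly S n l)
    + (\<Sum>l=k..<n + 1. p_poly S n l)"
proof -
  let ?c = "if 1 \<in> T then [:0, 1:] else (0::real poly)"
  have "p_poly T (Suc n) k =
      (\<Sum>w | w permutes {1..n + 1}. des_weight T (Suc (n + 1)) (prepend k w))"
    unfolding p_poly_altdef
    using sum.reindex_bij_betw[OF bij_betw_prepend[OF assms(1)], of "des_weight T (Suc (n + 1))"]
    by simp
  also have "\<dots> = (\<Sum>w | w permutes {1..n + 1}. (if w 1 \<le> k then ?c else 1) * des_weight S (n + 1) w)"
    unfolding S_def by (intro sum.cong refl des_weight_prepend) simp
  also have "\<dots> = (\<Sum>l<n + 1. \<Sum>w | w permutes {1..n + 1} \<and> w 1 = l + 1.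
      (if w 1 \<le> k then ?c else 1) * des_weight S (n + 1) w)"
    by (rule sum_permutes_by_first)
  also have "\<dots> = (\<Sum>l<n + 1. (if l < k then ?c else 1) * p_poly S n l)"
    unfolding p_poly_altdef sum_distrib_left by (intro sum.cong refl) auto
  also have "{..<n + 1} = {..<k} \<union> {k..<n + 1}"
    using assms(1) by auto
  also have "(\<Sum>l\<in>\<dots>. (if l < k then ?c else 1) * p_poly S n l) =
      (\<Sum>l<k. (if l < k then ?c else 1) * p_poly S n l)
      + (\<Sum>l=k..<n + 1. (if l < k then ?c else 1) * p_poly S n l)"
    by (rule sum.union_disjoint) auto
  also have "(\<Sum>l<k. (if l < k then ?c else 1) * p_poly S n l) = ?c * (\<Sum>l<k. p_poly S n l)"
    unfolding sum_distrib_left by (intro sum.cong) auto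
  also have "(\<Sum>l=k..<n + 1. (if l < k then ?c else 1) * p_poly S n l) = (\<Sum>l=k..<n + 1. p_poly S n l)"
    by (intro sum.cong) auto
  finally show ?thesis .
qed

lemma p_poly_0_0: "p_poly T 0 0 = 1"
proof -
  have "{w. w permutes {1..0 + 1} \<and> w 1 = 0 + 1 \<and> int ` Des (0 + 1) w \<subseteq> T} = {id}"
    by (auto simp: Des_def)
  then show ?thesis by (simp add: p_poly_def des_def Des_def)
qed

lemma sector_seq_p_poly: "sector_seq (Suc n) (p_poly T n)"
\<comment> \<open>\<open>T\<close> must vary, since the recursion passes to the shifted set.\<close>
proof (induction n arbitrary: T)
  case 0
  show ?case by (simp add: sector_seq_def p_poly_0_0)
next
  case (Suc n)
  show ?case
    by (rule sector_seq_step[OF Suc, where c = "if 1 \<in> T then [:0, 1:] else 0"])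
      (auto simp: p_poly_Suc)
qed

text \<open>All coefficients count permutations and are therefore nonnegative.\<close>

lemma lead_coeff_p_poly_pos: "p_poly T n k \<noteq> 0 \<Longrightarrow> lead_coeff (p_poly T n k) > 0"
  and lead_coeff_A_poly_pos: "A_poly T m \<noteq> 0 \<Longrightarrow> lead_coeff (A_poly T m) > 0"
proof -
  have *: "lead_coeff p > 0" if "p \<noteq> 0" "\<And>i. coeff p i \<ge> 0" for p :: "real poly"
    using that by (simp add: less_le)
  show "p_poly T n k \<noteq> 0 \<Longrightarrow> lead_coeff (p_poly T n k) > 0"
    by (rule *) (auto simp: p_poly_def coeff_sum intro!: sum_nonneg)
  show "A_poly T m \<noteq> 0 \<Longrightarrow> lead_coeff (A_poly T m) > 0"
    by (rule *) (auto simp: A_poly_def coeff_sum intro!: sum_nonneg)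
qed

theorem theorem3p1:
  fixes n :: nat and T :: "int set"
  assumes "T \<subseteq> {1..int n}"
  shows "interlacing_seq (map (p_poly T n) [0..<n + 1]) \<and>
         (n > 0 \<longrightarrow>
            real_rooted (A_poly ((\<lambda>a. a - 1) ` T) n) \<and>
            interlaces (A_poly ((\<lambda>a. a - 1) ` T) n) (A_poly T (n + 1)))"
proof (intro conjI impI)
  have sec: "sector_seq (n + 1) (p_poly T n)"
    using sector_seq_p_poly by simp
  have pair: "interlaces (p_poly T n i) (p_poly T n j)" if "i < j" "j < n + 1" for i j
    using sec that lead_coeff_p_poly_pos
    by (intro interlacesI) (auto simp: sector_seq_def sector_def)
  have rr: "real_rooted (p_poly T n i)" if "i < n + 1" for i
    using sec that real_rootedI[of "p_poly T n i"] unfolding sector_seq_def real_rooted_def by metis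
  show "interlacing_seq (map (p_poly T n) [0..<n + 1])"
    unfolding interlacing_seq_def using pair rr by (auto simp del: upt_Suc)
  assume "n > 0"
  then obtain m where n: "n = Suc m" by (auto simp: gr0_conv_Suc)
  \<comment> \<open>For \<open>k = 0\<close> the lower sum in the recursion is empty: a leading 1
    creates no descent. Both remaining claims thus concern the first member of the sequence.\<close>
  have A: "A_poly ((\<lambda>a. a - 1) ` T) n = p_poly T n 0"
    unfolding n using A_poly_eq_sum[of "(\<lambda>a. a - 1) ` T" m] by (simp add: p_poly_Suc lessThan_atLeast0)
  show "real_rooted (A_poly ((\<lambda>a. a - 1) ` T) n)"
    unfolding A by (rule rr) simp
  show "interlaces (A_poly ((\<lambda>a. a - 1) ` T) n) (A_poly T (n + 1))"
    unfolding A A_poly_eq_sum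
    using sec lead_coeff_p_poly_pos lead_coeff_A_poly_pos[of T "n + 1", unfolded A_poly_eq_sum]
    by (rule sector_seq_interlaces_sum) simp_all
qed

end
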